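(* Let $T$ be a non-degenerate simplex in $\mathbb{R}^d$ with vertices ${\bf v}_0,\ldots,{\bf v}_d$, circumcenter ${\bf c}$ and circumradius $R$, and let $P$ be an admissible domain for $T$. For $f\in W^2(P)$ and ${\bf w}\in P$ put $$p_f({\bf w}):=\sum_{i=0}^{d}b_i(\varphi({\bf w}))\Bigl(f({\bf v}_i)+\nabla f({\bf v}_i)\cdot\bigl({\bf w}-\varphi({\bf w})+\tfrac12({\bf c}-{\bf v}_i)\bigr)\Bigr),$$ and for ${\bf w}\in\mathbb{R}^d$ put $$\mathcal E({\bf w}):=\frac{R^2}{4}+|{\bf w}-\varphi({\bf w})|^2-\frac12|{\bf w}-{\bf c}|^2 .$$ Then the following hold. (1) For every ${\bf w}\in P$, the recovery method $f\mapsto p_f({\bf w})$ is optimal for recovery of $f({\bf w})$ on the class $W^2(P)$; that is, the mapping $\Psi^\ast:\mathbb{R}^{(d+1)^2}\to\mathbb{R}$ defined by $$\Psi^\ast(y_0,\ldots,y_d,{\bf z}_0,\ldots,{\bf z}_d):=\sum_{i=0}^{d}b_i(\varphi({\bf w}))\Bigl(y_i+{\bf z}_i\cdot\bigl({\bf w}-\varphi({\bf w})+\tfrac12({\bf c}-{\bf v}_i)\bigr)\Bigr),\qquad y_i\in\mathbb{R},\ {\bf z}_i\in\mathbb{R}^d,$$ for which $p_f({\bf w})=\Psi^\ast(I(f))$, satisfies $e_{\bf w}(W^2(P);\Psi^\ast)=e_{\bf w}(W^2(P))$. (In other words, the method $p_f$ is pointwise optimal on $W^2(P)$.) Moreover,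 for every ${\bf w}\in P$, $$e_{\bf w}(W^2(P))=\mathcal E({\bf w}).$$ (2) For every monotone seminorm $\|\cdot\|$ on $C(P)$, the method $p_f$ is optimal on $W^2(P)$ for global recovery in the seminorm $\|\cdot\|$; that is, the mapping $\Phi^\ast:\mathbb{R}^{(d+1)^2}\to C(P)$ defined by $$\Phi^\ast(y_0,\ldots,y_d,{\bf z}_0,\ldots,{\bf z}_d)({\bf w}):=\sum_{i=0}^{d}b_i(\varphi({\bf w}))\Bigl(y_i+{\bf z}_i\cdot\bigl({\bf w}-\varphi({\bf w})+\tfrac12({\bf c}-{\bf v}_i)\bigr)\Bigr),\qquad {\bf w}\in P,\ y_i\in\mathbb{R},\ {\bf z}_i\in\mathbb{R}^d,$$ for which $p_f=\Phi^\ast(I(f))$, satisfies $R(W^2(P);\Phi^\ast,\|\cdot\|)=R(W^2(P);\|\cdot\|)$. Moreover, $$R(W^2(P);\|\cdot\|)=\|\mathcal E\|.$$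
   Context: $|\cdot|$ is the Euclidean norm and ${\bf a}\cdot{\bf b}$ the dot product on $\mathbb{R}^d$. A simplex $T\subset\mathbb{R}^d$ with vertices ${\bf v}_0,\ldots,{\bf v}_d$ is non-degenerate if it is not contained in any $(d-1)$-dimensional hyperplane. Its circumcenter ${\bf c}$ is the point equidistant from all vertices; the circumradius is $R=|{\bf c}-{\bf v}_i|$. Let $\Sigma=\{0,1,\ldots,d\}$, ${\bf u}_i=\frac12({\bf c}+{\bf v}_i)$ for $i\in\Sigma$, and $U=\frac12({\bf c}+T)=\{\frac12({\bf c}+{\bf t}):{\bf t}\in T\}$, the simplex with vertices ${\bf u}_0,\ldots,{\bf u}_d$. For ${\bf x}\in U$, $b_0({\bf x}),\ldots,b_d({\bf x})$ are the barycentric coordinates of ${\bf x}$ relative to $U$: ${\bf x}=\sum_{i}b_i({\bf x}){\bf u}_i$, $\sum_i b_i({\bf x})=1$, $b_i({\bf x})\ge 0$. For non-empty $I\subset\Sigma$, $G_I:=\{{\bf x}\in U: b_i({\bf x})>0 \text{ for } i\in I,\ b_i({\bf x})=0\text{ for } i\notin I\}$. The mapping $\varphi:\mathbb{R}^d\to U$ sends ${\bf x}$ to the unique point of $U$ closest to ${\bf x}$. A closed convex set $P\subset\mathbb{R}^d$ is an admissible domain for $T$ if $P\supset T$ and for every ${\bf x}\in P$ we have ${\bf x}-\varphi({\bf x})+{\bf u}_i\in P$ for all $i\in I$, where $I\subset\Sigma$ is the (unique) subset such that $\varphi({\bf x})\in G_I$. $C(P)$ is the space of continuous real functions on $P$ and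 $C^1(P)$ the space of continuously differentiable real functions on $P$. $W^2_\infty[a,b]$ is the class of functions $g:[a,b]\to\mathbb{R}$ such that $g'$ is absolutely continuous on $[a,b]$ and $|g''(t)|\le 1$ for a.e. $t\in[a,b]$ (equivalently, $g'$ exists everywhere on $[a,b]$ and $|g'(t_1)-g'(t_2)|\le|t_1-t_2|$ for all $t_1,t_2\in[a,b]$). $W^2(P)$ is the class of $f\in C^1(P)$ such that for any two distinct points ${\bf x},{\bf y}\in P$, with $\rho=|{\bf y}-{\bf x}|$, the function $g(t)=f({\bf x}+\frac t\rho({\bf y}-{\bf x}))$, $t\in[0,\rho]$, belongs to $W^2_\infty[0,\rho]$. The information vector is $I(f):=(f({\bf v}_0),\ldots,f({\bf v}_d),\nabla f({\bf v}_0),\ldots,\nabla f({\bf v}_d))\in\mathbb{R}^{(d+1)^2}$. For a class $\mathcal F\subset C^1(P)$, ${\bf w}\in P$ and an arbitrary mapping $\Psi:\mathbb{R}^{(d+1)^2}\to\mathbb{R}$, $e_{\bf w}(\mathcal F;\Psi):=\sup_{f\in\mathcal F}|f({\bf w})-\Psi(I(f))|$ and $e_{\bf w}(\mathcal F):=\inf_{\Psi}e_{\bf w}(\mathcal F;\Psi)$, the infimum being over all mappings $\Psi:\mathbb{R}^{(d+1)^2}\to\mathbb{R}$. A seminorm $\|\cdot\|$ on $C(P)$ is monotone if $\|f_1\|\le\|f_2\|$ whenever $|f_1({\bf x})|\le|f_2({\bf x})|$ for every ${\bf x}\in P$. For an arbitrary mapping $\Phi:\mathbb{R}^{(d+1)^2}\to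 C(P)$, $R(\mathcal F;\Phi,\|\cdot\|):=\sup_{f\in\mathcal F}\|f-\Phi(I(f))\|$ and $R(\mathcal F;\|\cdot\|):=\inf_\Phi R(\mathcal F;\Phi,\|\cdot\|)$, the infimum being over all mappings $\Phi:\mathbb{R}^{(d+1)^2}\to C(P)$. In $\|\mathcal E\|$, $\mathcal E$ is understood as restricted to $P$. *)

theory Defs
  imports "HOL-Analysis.Analysis"
begin

text \<open>
  Points of $d$-dimensional Euclidean space are vectors of type \<open>real ^ 'n\<close>, $d$ being
  \<open>CARD('n)\<close>. The $d+1$ vertices of a simplex are indexed by a finite type \<open>'i\<close> in place of
  $\{0,\ldots,d\}$; the requirement \<open>CARD('i) = CARD('n) + 1\<close> is part of non-degeneracy.
  Functions on a domain \<open>P\<close> are represented by total functions of which only the values on \<open>P\<close>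
  matter.
\<close>

section \<open>The simplex and its circumcenter\<close>

definition simplex_of :: "('i::finite \<Rightarrow> real ^ 'n) \<Rightarrow> (real ^ 'n) set" where
  "simplex_of v = convex hull (range v)"

definition nondegenerate_simplex :: "('i::finite \<Rightarrow> real ^ 'n) \<Rightarrow> bool" where
  "nondegenerate_simplex v \<longleftrightarrow>
     CARD('i) = CARD('n) + 1 \<and> \<not> (\<exists>a b. a \<noteq> 0 \<and> simplex_of v \<subseteq> {x. a \<bullet> x = b})"

definition circumcenter :: "('i::finite \<Rightarrow> real ^ 'n) \<Rightarrow> real ^ 'n" where
  "circumcenter v = (THE c. \<forall>i j. dist c (v i) = dist c (v j))"

definition circumradius :: "('i::finite \<Rightarrow> real ^ 'n) \<Rightarrow> real" where
  "circumradius v = (THE r. \<forall>i. dist (circumcenter v) (v i) = r)"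

section \<open>The half-size simplex and the projection onto it\<close>

definition half_vertex :: "('i::finite \<Rightarrow> real ^ 'n) \<Rightarrow> 'i \<Rightarrow> real ^ 'n" where
  "half_vertex v i = (1/2) *\<^sub>R (circumcenter v + v i)"

definition half_simplex :: "('i::finite \<Rightarrow> real ^ 'n) \<Rightarrow> (real ^ 'n) set" where
  "half_simplex v = (\<lambda>t. (1/2) *\<^sub>R (circumcenter v + t)) ` simplex_of v"

definition bary :: "('i::finite \<Rightarrow> real ^ 'n) \<Rightarrow> real ^ 'n \<Rightarrow> 'i \<Rightarrow> real" where
  "bary v x = (THE b. x = (\<Sum>i\<in>UNIV. b i *\<^sub>R half_vertex v i) \<and> (\<Sum>i\<in>UNIV. b i) = 1 \<and> (\<forall>i. b i \<ge> 0))"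

definition open_face :: "('i::finite \<Rightarrow> real ^ 'n) \<Rightarrow> 'i set \<Rightarrow> (real ^ 'n) set" where
  "open_face v I =
     {x \<in> half_simplex v. (\<forall>i\<in>I. bary v x i > 0) \<and> (\<forall>i. i \<notin> I \<longrightarrow> bary v x i = 0)}"

definition proj :: "('i::finite \<Rightarrow> real ^ 'n) \<Rightarrow> real ^ 'n \<Rightarrow> real ^ 'n" where
  "proj v x = closest_point (half_simplex v) x"

definition admissible_domain :: "('i::finite \<Rightarrow> real ^ 'n) \<Rightarrow> (real ^ 'n) set \<Rightarrow> bool" where
  "admissible_domain v P \<longleftrightarrow>
     closed P \<and> convex P \<and> simplex_of v \<subseteq> P \<and>
     (\<forall>x\<in>P. \<forall>I. I \<noteq> {} \<and> proj v x \<in> open_face v I \<longrightarrow>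
        (\<forall>i\<in>I. x - proj v x + half_vertex v i \<in> P))"

section \<open>Function classes\<close>

definition C_space :: "(real ^ 'n) set \<Rightarrow> (real ^ 'n \<Rightarrow> real) set" where
  "C_space P = {f. continuous_on P f}"

text \<open>
  Derivatives are taken relative to \<open>P\<close>, so that they make sense at boundary points of \<open>P\<close>. When
  \<open>P\<close> is convex with non-empty interior, as every admissible domain is, they are unique and
  depend only on the restriction of \<open>f\<close> to \<open>P\<close>.
\<close>

definition grad :: "(real ^ 'n) set \<Rightarrow> (real ^ 'n \<Rightarrow> real) \<Rightarrow> real ^ 'n \<Rightarrow> real ^ 'n" where
  "grad P f x = (THE g. (f has_derivative (\<lambda>h. g \<bullet> h)) (at x within P))"

definition C1_space :: "(real ^ 'n) set \<Rightarrow> (real ^ 'n \<Rightarrow> real) set" where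
  "C1_space P = {f. f differentiable_on P \<and> continuous_on P (grad P f)}"

text \<open>
  Functions with absolutely continuous first derivative and second derivative bounded by $1$ almost
  everywhere, i.e. with $1$-Lipschitz first derivative.
\<close>

definition W2_interval :: "real \<Rightarrow> real \<Rightarrow> (real \<Rightarrow> real) set" where
  "W2_interval a b = {g. \<exists>g'.
     (\<forall>t\<in>{a..b}. (g has_real_derivative g' t) (at t within {a..b})) \<and>
     (\<forall>s\<in>{a..b}. \<forall>t\<in>{a..b}. \<bar>g' s - g' t\<bar> \<le> \<bar>s - t\<bar>)}"

definition W2_class :: "(real ^ 'n) set \<Rightarrow> (real ^ 'n \<Rightarrow> real) set" where
  "W2_class P = {f \<in> C1_space P. \<forall>x\<in>P. \<forall>y\<in>P. x \<noteq> y \<longrightarrow>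
     (\<lambda>t. f (x + (t / norm (y - x)) *\<^sub>R (y - x))) \<in> W2_interval 0 (norm (y - x))}"

section \<open>Information and optimal recovery\<close>

type_synonym ('n, 'i) info = "(real ^ 'i) \<times> ((real ^ 'n) ^ 'i)"

definition info :: "('i::finite \<Rightarrow> real ^ 'n) \<Rightarrow> (real ^ 'n) set \<Rightarrow> (real ^ 'n \<Rightarrow> real) \<Rightarrow> ('n, 'i) info" where
  "info v P f = ((\<chi> i. f (v i)), (\<chi> i. grad P f (v i)))"

text \<open>Errors are extended reals because the suprema over a class may be infinite.\<close>

definition point_error_of ::
  "('i::finite \<Rightarrow> real ^ 'n) \<Rightarrow> (real ^ 'n) set \<Rightarrow> real ^ 'n \<Rightarrow> (real ^ 'n \<Rightarrow> real) set
    \<Rightarrow> (('n, 'i) info \<Rightarrow> real) \<Rightarrow> ereal" where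
  "point_error_of v P w F \<Psi> = (SUP f\<in>F. ereal \<bar>f w - \<Psi> (info v P f)\<bar>)"

definition point_error ::
  "('i::finite \<Rightarrow> real ^ 'n) \<Rightarrow> (real ^ 'n) set \<Rightarrow> real ^ 'n \<Rightarrow> (real ^ 'n \<Rightarrow> real) set \<Rightarrow> ereal" where
  "point_error v P w F = (INF \<Psi>. point_error_of v P w F \<Psi>)"

text \<open>
  A seminorm on continuous functions on \<open>P\<close>; monotonicity forces its value to depend only on
  the restriction of its argument to \<open>P\<close>.
\<close>

definition monotone_seminorm :: "(real ^ 'n) set \<Rightarrow> ((real ^ 'n \<Rightarrow> real) \<Rightarrow> real) \<Rightarrow> bool" where
  "monotone_seminorm P N \<longleftrightarrow>
     (\<forall>f\<in>C_space P. 0 \<le> N f) \<and>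
     (\<forall>f\<in>C_space P. \<forall>a. N (\<lambda>x. a * f x) = \<bar>a\<bar> * N f) \<and>
     (\<forall>f\<in>C_space P. \<forall>g\<in>C_space P. N (\<lambda>x. f x + g x) \<le> N f + N g) \<and>
     (\<forall>f\<in>C_space P. \<forall>g\<in>C_space P. (\<forall>x\<in>P. \<bar>f x\<bar> \<le> \<bar>g x\<bar>) \<longrightarrow> N f \<le> N g)"

definition global_error_of ::
  "('i::finite \<Rightarrow> real ^ 'n) \<Rightarrow> (real ^ 'n) set \<Rightarrow> ((real ^ 'n \<Rightarrow> real) \<Rightarrow> real)
    \<Rightarrow> (real ^ 'n \<Rightarrow> real) set \<Rightarrow> (('n, 'i) info \<Rightarrow> real ^ 'n \<Rightarrow> real) \<Rightarrow> ereal" where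
  "global_error_of v P N F \<Phi> = (SUP f\<in>F. ereal (N (\<lambda>x. f x - \<Phi> (info v P f) x)))"

definition global_error ::
  "('i::finite \<Rightarrow> real ^ 'n) \<Rightarrow> (real ^ 'n) set \<Rightarrow> ((real ^ 'n \<Rightarrow> real) \<Rightarrow> real)
    \<Rightarrow> (real ^ 'n \<Rightarrow> real) set \<Rightarrow> ereal" where
  "global_error v P N F = (INF \<Phi>\<in>UNIV \<rightarrow> C_space P. global_error_of v P N F \<Phi>)"

section \<open>The recovery method and its error function\<close>

definition recovery :: "('i::finite \<Rightarrow> real ^ 'n) \<Rightarrow> ('n, 'i) info \<Rightarrow> real ^ 'n \<Rightarrow> real" where
  "recovery v Y w = (\<Sum>i\<in>UNIV. bary v (proj v w) i *
     (fst Y $ i + (snd Y $ i) \<bullet> (w - proj v w + (1/2) *\<^sub>R (circumcenter v - v i))))"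

definition p_method ::
  "('i::finite \<Rightarrow> real ^ 'n) \<Rightarrow> (real ^ 'n) set \<Rightarrow> (real ^ 'n \<Rightarrow> real) \<Rightarrow> real ^ 'n \<Rightarrow> real" where
  "p_method v P f w = (\<Sum>i\<in>UNIV. bary v (proj v w) i *
     (f (v i) + grad P f (v i) \<bullet> (w - proj v w + (1/2) *\<^sub>R (circumcenter v - v i))))"

definition err_fun :: "('i::finite \<Rightarrow> real ^ 'n) \<Rightarrow> real ^ 'n \<Rightarrow> real" where
  "err_fun v w = (circumradius v)\<^sup>2 / 4 + (norm (w - proj v w))\<^sup>2
     - (norm (w - circumcenter v))\<^sup>2 / 2"

end

theory Submission
  imports Defs
begin

text \<open>
  The error function \<open>E = err_fun v\<close> has gradient \<open>w + c - 2 \<phi>(w)\<close>, which is 1-Lipschitz because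
  the projection \<open>\<phi>\<close> is firmly nonexpansive, and \<open>E\<close> vanishes to first order at every vertex.
  Hence \<open>E\<close> and \<open>-E\<close> both lie in the class and cannot be distinguished by the information, so
  no method has error below \<open>E\<close>. For the upper bound, put \<open>w_i = w - \<phi>(w) + u_i\<close> with weights
  \<open>b_i = b_i(\<phi>(w))\<close>, so that \<open>w\<close> is the weighted mean of the \<open>w_i\<close>. Taylor expansion of \<open>f\<close> from
  \<open>v_i\<close> to \<open>w_i\<close> and from \<open>w\<close> to \<open>w_i\<close> bounds the error by
  \<open>\<Sum>i. b_i (|w_i - v_i|^2 + |w_i - w|^2) / 2\<close>, which equals \<open>E(w)\<close>.
\<close>

section \<open>Projections onto closed convex sets\<close>

text \<open>Each projection satisfies its variational inequality; testing each with the other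
  projection and adding the two gives the bound.\<close>

lemma closest_point_firmly_nonexpansive:
  fixes S :: "'a::euclidean_space set"
  assumes "convex S" "closed S" "S \<noteq> {}"
  shows "(norm (closest_point S x - closest_point S y))\<^sup>2
    \<le> (x - y) \<bullet> (closest_point S x - closest_point S y)"
proof -
  let ?p = "closest_point S x" and ?q = "closest_point S y"
  have "?p \<in> S" "?q \<in> S"
    using assms by (auto intro: closest_point_in_set)
  then have "(x - ?p) \<bullet> (?q - ?p) \<le> 0" "(y - ?q) \<bullet> (?p - ?q) \<le> 0"
    using assms by (auto intro: closest_point_dot)
  then show ?thesis
    unfolding power2_norm_eq_inner by (simp add: inner_diff inner_commute)
qed

lemma has_derivative_quadratic_bound:
  fixes f :: "'a::real_normed_vector \<Rightarrow> real"
  assumes "bounded_linear L" and bound: "\<And>y. \<bar>f y - f x - L (y - x)\<bar> \<le> C * (norm (y - x))\<^sup>2"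
  shows "(f has_derivative L) (at x within S)"
  unfolding has_derivative_within
proof (intro conjI assms(1))
  have "norm ((1 / norm (y - x)) *\<^sub>R (f y - (f x + L (y - x)))) \<le> C * norm (y - x)" for y
    using bound[of y]
    by (cases "y = x") (simp_all add: abs_mult diff_diff_eq[symmetric] divide_simps power2_eq_square)
  moreover have "((\<lambda>y. C * norm (y - x)) \<longlongrightarrow> 0) (at x within S)"
    by (auto intro!: tendsto_eq_intros)
  ultimately show "((\<lambda>y. (1 / norm (y - x)) *\<^sub>R (f y - (f x + L (y - x)))) \<longlongrightarrow> 0) (at x within S)"
    by (rule Lim_null_comparison[OF always_eventually[OF allI]])
qed

text \<open>The increment is sandwiched by using each projection as a competitor for the other
  point. \<open>?p\<close> tested at \<open>y\<close> bounds the remainder above; \<open>?q\<close>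
  tested at \<open>x\<close>, with the nonexpansiveness of the projection, bounds it below.\<close>

lemma has_derivative_dist_squared:
  fixes S :: "'a::euclidean_space set"
  assumes "convex S" "closed S" "S \<noteq> {}"
  shows "((\<lambda>x. (norm (x - closest_point S x))\<^sup>2) has_derivative
    (\<lambda>h. (2 *\<^sub>R (x - closest_point S x)) \<bullet> h)) (at x within X)"
proof (rule has_derivative_quadratic_bound[where C = 1])
  show "bounded_linear (\<lambda>h. (2 *\<^sub>R (x - closest_point S x)) \<bullet> h)"
    by (rule bounded_linear_inner_right)
next
  fix y
  let ?p = "closest_point S x" and ?q = "closest_point S y"
  have S: "?p \<in> S" "?q \<in> S"
    using assms by (auto intro: closest_point_in_set)
  have "(norm (y - ?q))\<^sup>2 \<le> (norm (y - ?p))\<^sup>2" "(norm (x - ?p))\<^sup>2 \<le> (norm (x - ?q))\<^sup>2"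
    using closest_point_le[OF assms(2) S(1), of y] closest_point_le[OF assms(2) S(2), of x]
    by (auto simp: dist_norm intro!: power_mono)
  moreover have "(y - x) \<bullet> (?q - ?p) \<le> (norm (y - x))\<^sup>2"
  proof -
    have "(y - x) \<bullet> (?q - ?p) \<le> norm (y - x) * norm (?q - ?p)"
      by (rule norm_cauchy_schwarz)
    also have "\<dots> \<le> norm (y - x) * norm (y - x)"
      using closest_point_lipschitz[OF assms, of y x] by (auto simp: dist_norm intro: mult_left_mono)
    finally show ?thesis by (simp add: power2_eq_square)
  qed
  moreover define e m k where "e = y - x" and "m = x - ?p" and "k = ?q - ?p"
  then have "y - x = e" "x - ?p = m" "?q - ?p = k" "y - ?p = e + m" "x - ?q = m - k"
    "y - ?q = (m - k) + e"
    by simp_all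
  ultimately have "((m - k) + e) \<bullet> ((m - k) + e) \<le> (e + m) \<bullet> (e + m)"
    "m \<bullet> m \<le> (m - k) \<bullet> (m - k)" "e \<bullet> k \<le> e \<bullet> e"
    by (simp_all add: power2_norm_eq_inner)
  then have "\<bar>((m - k) + e) \<bullet> ((m - k) + e) - m \<bullet> m - 2 * (m \<bullet> e)\<bar> \<le> e \<bullet> e"
    by (simp add: inner_add inner_diff_left inner_diff_right inner_commute)
  then show "\<bar>(norm (y - ?q))\<^sup>2 - (norm (x - ?p))\<^sup>2 - (2 *\<^sub>R (x - ?p)) \<bullet> (y - x)\<bar>
      \<le> 1 * (norm (y - x))\<^sup>2"
    by (simp add: \<open>y - ?q = (m - k) + e\<close> \<open>x - ?p = m\<close> \<open>y - x = e\<close> power2_norm_eq_inner)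
qed

section \<open>Taylor bounds\<close>

lemma taylor_bound_Lipschitz_derivative:
  fixes g :: "real \<Rightarrow> real"
  assumes "0 \<le> r"
    and der: "\<And>t. t \<in> {0..r} \<Longrightarrow> (g has_real_derivative g' t) (at t within {0..r})"
    and lip: "\<And>t. t \<in> {0..r} \<Longrightarrow> \<bar>g' t - g' 0\<bar> \<le> t"
  shows "\<bar>g r - g 0 - g' 0 * r\<bar> \<le> r\<^sup>2 / 2"
proof -
  have bound: "h r - h 0 - h' 0 * r \<le> r\<^sup>2 / 2"
    if der: "\<And>t. t \<in> {0..r} \<Longrightarrow> (h has_real_derivative h' t) (at t within {0..r})"
      and lip: "\<And>t. t \<in> {0..r} \<Longrightarrow> h' t - h' 0 \<le> t" for h h' :: "real \<Rightarrow> real"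
  proof -
    \<comment> \<open>The derivative of this auxiliary function is nonpositive, so it cannot
      increase on the interval; the two-sided bound follows by applying this to \<open>g\<close> and
      \<open>- g\<close>.\<close>
    have "((\<lambda>t. h t - h' 0 * t - t\<^sup>2 / 2) has_derivative (*) (h' t - h' 0 - t)) (at t within {0..r})"
      if "0 \<le> t" "t \<le> r" for t
      using that unfolding has_field_derivative_def[symmetric]
      by (auto intro!: derivative_eq_intros der)
    from mvt_very_simple[OF \<open>0 \<le> r\<close> this] obtain t where "t \<in> {0..r}"
      "(h r - h' 0 * r - r\<^sup>2 / 2) - (h 0 - h' 0 * 0 - 0\<^sup>2 / 2) = (h' t - h' 0 - t) * (r - 0)"
      by blast
    moreover have "(h' t - h' 0 - t) * (r - 0) \<le> 0"
      using lip[OF \<open>t \<in> {0..r}\<close>] \<open>0 \<le> r\<close> by (simp add: mult_nonpos_nonneg)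
    ultimately show ?thesis by simp
  qed
  have "g r - g 0 - g' 0 * r \<le> r\<^sup>2 / 2"
    using lip by (intro bound der) (auto simp: abs_le_iff)
  moreover have "- g r - - g 0 - - g' 0 * r \<le> r\<^sup>2 / 2"
    by (rule bound[where h = "\<lambda>t. - g t" and h' = "\<lambda>t. - g' t"])
      (use lip in \<open>auto simp: abs_le_iff intro!: DERIV_minus der\<close>)
  ultimately show ?thesis by linarith
qed

section \<open>Barycentric coordinates and the circumcenter\<close>

context
  fixes v :: "'i::finite \<Rightarrow> real ^ 'n"
  assumes nondeg: "nondegenerate_simplex v"
begin

text \<open>This is the form in which non-degeneracy enters: a hyperplane through all vertices
  contains their hull, so its normal must vanish.\<close>

lemma normal_eq_0:
  assumes "\<And>i. a \<bullet> v i = b"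
  shows "a = 0"
proof -
  have "simplex_of v \<subseteq> {x. a \<bullet> x = b}"
    unfolding simplex_of_def using assms by (intro hull_minimal convex_hyperplane) auto
  then show ?thesis
    using nondeg unfolding nondegenerate_simplex_def by blast
qed

text \<open>Evaluation at the vertices sends affine functions to value vectors. It is injective by
  \<open>normal_eq_0\<close>, and both spaces have dimension d + 1, hence it is onto.\<close>

lemma affine_interpolation:
  obtains a s where "\<And>i. a \<bullet> v i + s = y i"
proof -
  define M :: "(real ^ 'n) \<times> real \<Rightarrow> real ^ 'i" where "M p = (\<chi> i. fst p \<bullet> v i + snd p)" for p
  have lin: "linear M"
    by (rule linearI) (auto simp: M_def vec_eq_iff inner_add_left algebra_simps)
  have "inj M"
    unfolding linear_injective_0[OF lin]
  proof (intro allI impI)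
    fix p assume "M p = 0"
    then have p: "fst p \<bullet> v i + snd p = 0" for i
      by (simp add: M_def vec_eq_iff)
    then have "fst p = 0"
      by (intro normal_eq_0[of _ "- snd p"]) (simp add: eq_neg_iff_add_eq_0)
    with p show "p = 0"
      by (simp add: prod_eq_iff)
  qed
  then have "dim (range M) = dim (UNIV :: ((real ^ 'n) \<times> real) set)"
    using lin by (intro dim_image_eq) (auto intro: inj_on_subset)
  also have "\<dots> = DIM(real ^ 'i)"
    using nondeg by (simp add: nondegenerate_simplex_def)
  finally have "span (range M) = UNIV"
    by (simp only: dim_eq_full)
  then have "range M = UNIV"
    using linear_subspace_image[OF lin subspace_UNIV] span_eq_iff by blast
  then obtain p where "M p = (\<chi> i. y i)"
    by (metis UNIV_I imageE)
  then show ?thesis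
    by (intro that[of "fst p" "snd p"]) (simp add: M_def vec_eq_iff)
qed

text \<open>Interpolating the indicator of vertex \<open>i\<close> shows that a barycentric
  coordinate is an affine function of the point; uniqueness and continuity of \<open>bary\<close>
  both rest on this.\<close>

lemma barycentric_coordinate:
  obtains a s where "\<And>b. (\<Sum>j\<in>UNIV. b j) = 1 \<Longrightarrow> a \<bullet> (\<Sum>j\<in>UNIV. b j *\<^sub>R v j) + s = b i"
proof -
  obtain a s where as: "\<And>j. a \<bullet> v j + s = (if j = i then 1 else 0)"
    using affine_interpolation[of "\<lambda>j. if j = i then 1 else 0"] by blast
  have "a \<bullet> (\<Sum>j\<in>UNIV. b j *\<^sub>R v j) + s = b i" if "(\<Sum>j\<in>UNIV. b j) = 1" for b
  proof -
    have "a \<bullet> (\<Sum>j\<in>UNIV. b j *\<^sub>R v j) + s = (\<Sum>j\<in>UNIV. b j * (a \<bullet> v j + s))"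
      using that by (simp add: inner_sum_right distrib_left sum.distrib sum_distrib_right[symmetric])
    then show ?thesis
      by (simp add: as if_distrib cong: if_cong)
  qed
  then show ?thesis by (rule that)
qed

lemma inj_vertices: "inj v"
proof (rule injI, rule ccontr)
  fix i j assume "v i = v j" "i \<noteq> j"
  obtain a s where "\<And>k. a \<bullet> v k + s = (if k = i then 1 else 0)"
    using affine_interpolation[of "\<lambda>k. if k = i then 1 else 0"] by blast
  then show False
    using \<open>v i = v j\<close> \<open>i \<noteq> j\<close> by (metis zero_neq_one)
qed

lemma simplex_of_eq:
  "simplex_of v = {\<Sum>i\<in>UNIV. b i *\<^sub>R v i | b. (\<Sum>i\<in>UNIV. b i) = 1 \<and> (\<forall>i. 0 \<le> b i)}"
  (is "_ = ?rhs")
proof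
  show "simplex_of v \<subseteq> ?rhs"
  proof
    fix x assume "x \<in> simplex_of v"
    then obtain u where "\<forall>y\<in>range v. 0 \<le> u y" "sum u (range v) = 1" "(\<Sum>y\<in>range v. u y *\<^sub>R y) = x"
      by (auto simp: simplex_of_def convex_hull_finite)
    then show "x \<in> ?rhs"
      using inj_vertices by (auto simp: sum.reindex intro!: exI[of _ "u \<circ> v"])
  qed
next
  show "?rhs \<subseteq> simplex_of v"
  proof clarify
    fix b :: "'i \<Rightarrow> real" assume "(\<Sum>i\<in>UNIV. b i) = 1" "\<forall>i. 0 \<le> b i"
    then show "(\<Sum>i\<in>UNIV. b i *\<^sub>R v i) \<in> simplex_of v"
      unfolding simplex_of_def by (intro convex_sum[OF _ convex_convex_hull]) (auto intro: hull_inc)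
  qed
qed

lemma ex1_circumcenter: "\<exists>!c. \<forall>i j. dist c (v i) = dist c (v j)"
proof -
  \<comment> \<open>In the expansion of the squared distance from \<open>c\<close> to
    \<open>v i\<close>, equidistance says that
    \<open>(norm (v i))\<^sup>2 / 2 - c \<bullet> v i\<close> does not depend on \<open>i\<close>;
    the linear part \<open>a\<close> of this interpolant is therefore the circumcenter.\<close>
  obtain a s where as: "\<And>i. a \<bullet> v i + s = (norm (v i))\<^sup>2 / 2"
    using affine_interpolation[of "\<lambda>i. (norm (v i))\<^sup>2 / 2"] by blast
  have sq: "(dist c (v i))\<^sup>2 = (norm c)\<^sup>2 - 2 * (c \<bullet> v i) + (norm (v i))\<^sup>2" for c i
    unfolding dist_norm power2_norm_eq_inner by (simp add: inner_diff inner_commute)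
  show ?thesis
  proof (rule ex1I)
    have "(dist a (v i))\<^sup>2 = (norm a)\<^sup>2 + 2 * s" for i
      using as[of i] by (simp add: sq)
    then have "dist a (v i) = dist a (v j)" for i j
      by (metis power2_eq_imp_eq zero_le_dist)
    then show "\<forall>i j. dist a (v i) = dist a (v j)" by blast
    fix c assume c: "\<forall>i j. dist c (v i) = dist c (v j)"
    fix k :: 'i
    have "(c - a) \<bullet> v i = (c - a) \<bullet> v k" for i
    proof -
      have "(dist c (v i))\<^sup>2 = (dist c (v k))\<^sup>2"
        using c by metis
      with as[of i] as[of k] show ?thesis
        by (simp add: sq inner_diff)
    qed
    then show "c = a"
      using normal_eq_0[of "c - a"] by auto
  qed
qed

lemma dist_circumcenter: "dist (circumcenter v) (v i) = circumradius v"
proof -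
  have "\<forall>i j. dist (circumcenter v) (v i) = dist (circumcenter v) (v j)"
    unfolding circumcenter_def by (rule theI'[OF ex1_circumcenter])
  then show ?thesis
    unfolding circumradius_def by (intro the_equality[symmetric]) metis+
qed

section \<open>The half-size simplex, its barycentric coordinates and its projection\<close>

lemma convex_half_simplex: "convex (half_simplex v)"
proof -
  have "half_simplex v = (\<lambda>t. (1/2) *\<^sub>R circumcenter v + (1/2) *\<^sub>R t) ` simplex_of v"
    unfolding half_simplex_def by (simp add: scaleR_add_right)
  then show ?thesis
    by (simp add: simplex_of_def convex_affinity)
qed

lemma closed_half_simplex: "closed (half_simplex v)"
  unfolding half_simplex_def simplex_of_def
  by (intro compact_imp_closed compact_continuous_image continuous_intros compact_convex_hull
      finite_imp_compact) auto

lemma half_simplex_nonempty: "half_simplex v \<noteq> {}"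
  by (simp add: half_simplex_def simplex_of_def)

lemmas half_simplex = convex_half_simplex closed_half_simplex half_simplex_nonempty

lemma vertex_in_simplex: "v i \<in> simplex_of v"
  by (simp add: simplex_of_def hull_inc)

lemma proj_in_half_simplex: "proj v x \<in> half_simplex v"
  unfolding proj_def using half_simplex by (intro closest_point_in_set)

lemma continuous_on_proj: "continuous_on X (proj v)"
  unfolding proj_def by (rule continuous_on_closest_point[OF half_simplex])

lemma sum_half_vertex:
  assumes "(\<Sum>i\<in>UNIV. b i) = 1"
  shows "(\<Sum>i\<in>UNIV. b i *\<^sub>R half_vertex v i)
    = (1/2) *\<^sub>R (circumcenter v + (\<Sum>i\<in>UNIV. b i *\<^sub>R v i))"
proof -
  have "(\<Sum>i\<in>UNIV. b i *\<^sub>R half_vertex v i)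
    = (1/2) *\<^sub>R ((\<Sum>i\<in>UNIV. b i) *\<^sub>R circumcenter v + (\<Sum>i\<in>UNIV. b i *\<^sub>R v i))"
    by (simp add: half_vertex_def scaleR_sum_right scaleR_sum_left scaleR_add_right sum.distrib
        mult.commute)
  with assms show ?thesis by simp
qed

lemma ex1_bary:
  assumes "x \<in> half_simplex v"
  shows "\<exists>!b. x = (\<Sum>i\<in>UNIV. b i *\<^sub>R half_vertex v i) \<and> (\<Sum>i\<in>UNIV. b i) = 1 \<and> (\<forall>i. b i \<ge> 0)"
proof -
  obtain b where b: "(\<Sum>i\<in>UNIV. b i) = 1" "\<forall>i. 0 \<le> b i"
    "x = (1/2) *\<^sub>R (circumcenter v + (\<Sum>i\<in>UNIV. b i *\<^sub>R v i))"
    using assms by (auto simp: half_simplex_def simplex_of_eq)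
  show ?thesis
  proof (intro ex1I conjI)
    show "x = (\<Sum>i\<in>UNIV. b i *\<^sub>R half_vertex v i)"
      using b sum_half_vertex[of b] by simp
  next
    fix b' assume b': "x = (\<Sum>i\<in>UNIV. b' i *\<^sub>R half_vertex v i) \<and> (\<Sum>i\<in>UNIV. b' i) = 1 \<and> (\<forall>i. 0 \<le> b' i)"
    then have "(\<Sum>i\<in>UNIV. b' i *\<^sub>R v i) = (\<Sum>i\<in>UNIV. b i *\<^sub>R v i)"
      using b sum_half_vertex[of b'] by simp
    then have "b' i = b i" for i
      using barycentric_coordinate[of i] b(1) b' by metis
    then show "b' = b" by blast
  qed (use b in auto)
qed

lemma bary:
  assumes "x \<in> half_simplex v"
  shows "x = (\<Sum>i\<in>UNIV. bary v x i *\<^sub>R half_vertex v i)" "(\<Sum>i\<in>UNIV. bary v x i) = 1"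
    "0 \<le> bary v x i"
  using theI'[OF ex1_bary[OF assms]] unfolding bary_def by auto

lemma continuous_on_bary: "continuous_on (half_simplex v) (\<lambda>x. bary v x i)"
proof -
  obtain a s where as: "\<And>b. (\<Sum>j\<in>UNIV. b j) = 1 \<Longrightarrow> a \<bullet> (\<Sum>j\<in>UNIV. b j *\<^sub>R v j) + s = b i"
    by (rule barycentric_coordinate[of i]) blast
  \<comment> \<open>The map \<open>2 *\<^sub>R x - circumcenter v\<close> undoes the halving and
    keeps the weights, so the coordinate is affine on the half-size simplex.\<close>
  have "bary v x i = a \<bullet> (2 *\<^sub>R x - circumcenter v) + s" if "x \<in> half_simplex v" for x
  proof -
    have "x = (1/2) *\<^sub>R (circumcenter v + (\<Sum>j\<in>UNIV. bary v x j *\<^sub>R v j))"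
      using bary[OF that] sum_half_vertex[of "bary v x"] by simp
    then have "2 *\<^sub>R x - circumcenter v
        = 2 *\<^sub>R ((1/2) *\<^sub>R (circumcenter v + (\<Sum>j\<in>UNIV. bary v x j *\<^sub>R v j))) - circumcenter v"
      by (rule arg_cong)
    then have "2 *\<^sub>R x - circumcenter v = (\<Sum>j\<in>UNIV. bary v x j *\<^sub>R v j)"
      by simp
    then show ?thesis
      using as[OF bary(2)[OF that]] by simp
  qed
  then show ?thesis
    by (subst continuous_on_cong[OF refl]) (auto intro!: continuous_intros)
qed

lemma continuous_on_recovery: "continuous_on X (recovery v Y)"
proof -
  have "continuous_on X (\<lambda>w. bary v (proj v w) i)" for i
    by (rule continuous_on_compose2[OF continuous_on_bary continuous_on_proj])
      (auto intro: proj_in_half_simplex)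
  then show ?thesis
    unfolding recovery_def by (intro continuous_intros continuous_on_proj)
qed

text \<open>The simplex lies in its circumscribed ball, so the half-size simplex lies in the
  concentric ball of half the radius. The midpoint of center and vertex is the point of that smaller
  ball nearest to the vertex.\<close>

lemma proj_vertex: "proj v (v i) = half_vertex v i"
  unfolding proj_def
proof (rule sym, rule closest_point_unique[OF convex_half_simplex closed_half_simplex])
  show "half_vertex v i \<in> half_simplex v"
    by (auto simp: half_vertex_def half_simplex_def intro: vertex_in_simplex)
  show "\<forall>z\<in>half_simplex v. dist (v i) (half_vertex v i) \<le> dist (v i) z"
  proof
    fix z assume "z \<in> half_simplex v"
    then obtain t where z: "z = (1/2) *\<^sub>R (circumcenter v + t)" and t: "t \<in> simplex_of v"
      by (auto simp: half_simplex_def)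
    have "simplex_of v \<subseteq> cball (circumcenter v) (circumradius v)"
      unfolding simplex_of_def
      by (intro hull_minimal convex_cball) (auto simp: dist_circumcenter)
    with t have "dist (circumcenter v) t \<le> circumradius v" by auto
    then have "norm (t - circumcenter v) \<le> norm (v i - circumcenter v)"
      using dist_circumcenter[of i] by (simp add: dist_norm norm_minus_commute)
    then have "norm ((1/2) *\<^sub>R (v i - circumcenter v))
        \<le> norm (v i - circumcenter v) - norm ((1/2) *\<^sub>R (t - circumcenter v))"
      by simp
    also have "\<dots> \<le> norm ((v i - circumcenter v) - (1/2) *\<^sub>R (t - circumcenter v))"
      by (rule norm_triangle_ineq2)
    also have "(v i - circumcenter v) - (1/2) *\<^sub>R (t - circumcenter v) = v i - z"
      by (simp add: z vec_eq_iff field_simps)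
    also have "(1/2) *\<^sub>R (v i - circumcenter v) = v i - half_vertex v i"
      by (simp add: half_vertex_def vec_eq_iff field_simps)
    finally show "dist (v i) (half_vertex v i) \<le> dist (v i) z"
      by (simp add: dist_norm)
  qed
qed

section \<open>The error function\<close>

definition err_grad where "err_grad w = w + circumcenter v - 2 *\<^sub>R proj v w"

lemma err_fun_has_derivative: "(err_fun v has_derivative (\<bullet>) (err_grad w)) (at w within X)"
proof -
  have "((\<lambda>w. ((w - circumcenter v) \<bullet> (w - circumcenter v)) / 2) has_derivative
      (\<lambda>h. (w - circumcenter v) \<bullet> h)) (at w within X)"
    by (rule derivative_eq_intros refl | simp add: inner_commute)+
  from has_derivative_diff[OF has_derivative_add[OF has_derivative_const[of "(circumradius v)\<^sup>2 / 4"]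
      has_derivative_dist_squared[OF half_simplex, of w X]] this]
  have "(err_fun v has_derivative (\<lambda>h. 0 + (2 *\<^sub>R (w - proj v w)) \<bullet> h - (w - circumcenter v) \<bullet> h))
      (at w within X)"
    by (simp only: err_fun_def[abs_def] proj_def power2_norm_eq_inner[of "_ - circumcenter v"])
  moreover have "(\<lambda>h. 0 + (2 *\<^sub>R (w - proj v w)) \<bullet> h - (w - circumcenter v) \<bullet> h) = (\<bullet>) (err_grad w)"
    by (simp add: fun_eq_iff err_grad_def inner_add_left inner_diff_left)
  ultimately show ?thesis by simp
qed

text \<open>With \<open>e\<close> and \<open>d\<close> as below, the squared norm of
  \<open>e - 2 *\<^sub>R d\<close> is that of \<open>e\<close> minus
  \<open>4 * (e \<bullet> d - d \<bullet> d)\<close>, and firm nonexpansiveness makes the subtracted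
  term nonnegative.\<close>

lemma norm_err_grad_diff_le: "norm (err_grad x - err_grad y) \<le> norm (x - y)"
proof (rule power2_le_imp_le)
  define d e where "d = proj v x - proj v y" and "e = x - y"
  have "(norm d)\<^sup>2 \<le> e \<bullet> d"
    unfolding d_def e_def proj_def by (rule closest_point_firmly_nonexpansive[OF half_simplex])
  moreover have "err_grad x - err_grad y = e - 2 *\<^sub>R d"
    by (simp add: err_grad_def d_def e_def algebra_simps)
  ultimately show "(norm (err_grad x - err_grad y))\<^sup>2 \<le> (norm (x - y))\<^sup>2"
    unfolding power2_norm_eq_inner e_def[symmetric] by (simp add: inner_diff inner_commute)
qed simp

lemma continuous_on_err_fun: "continuous_on X (err_fun v)"
  by (rule has_derivative_continuous_on[OF err_fun_has_derivative])

lemma err_fun_vertex: "err_fun v (v i) = 0" and err_grad_vertex: "err_grad (v i) = 0"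
proof -
  have "v i - half_vertex v i = (1/2) *\<^sub>R (v i - circumcenter v)"
    by (simp add: half_vertex_def vec_eq_iff field_simps)
  then show "err_fun v (v i) = 0"
    using dist_circumcenter[of i]
    by (simp add: err_fun_def proj_vertex dist_norm norm_minus_commute power_divide)
  show "err_grad (v i) = 0"
    by (simp add: err_grad_def proj_vertex half_vertex_def)
qed

section \<open>Functions on an admissible domain\<close>

context
  fixes P
  assumes adm: "admissible_domain v P"
begin

lemma convex_domain: "convex P" and simplex_subset_domain: "simplex_of v \<subseteq> P"
  using adm by (auto simp: admissible_domain_def)

lemma vertex_in_domain: "v i \<in> P"
  using vertex_in_simplex simplex_subset_domain by blast

lemma shift_in_domain:
  assumes "x \<in> P" "proj v x \<in> open_face v I" "i \<in> I"
  shows "x - proj v x + half_vertex v i \<in> P"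
proof -
  have "\<forall>x\<in>P. \<forall>I. I \<noteq> {} \<and> proj v x \<in> open_face v I \<longrightarrow> (\<forall>i\<in>I. x - proj v x + half_vertex v i \<in> P)"
    using adm unfolding admissible_domain_def by (elim conjE)
  from bspec[OF this assms(1)]
  have "I \<noteq> {} \<and> proj v x \<in> open_face v I \<longrightarrow> (\<forall>i\<in>I. x - proj v x + half_vertex v i \<in> P)"
    by (rule spec)
  then show ?thesis
    using assms(2,3) by blast
qed

lemma segment_in_domain:
  assumes "x \<in> P" "y \<in> P" "x \<noteq> y" "t \<in> {0..norm (y - x)}"
  shows "x + (t / norm (y - x)) *\<^sub>R (y - x) \<in> P"
proof -
  have "x + (t / norm (y - x)) *\<^sub>R (y - x)
      = (1 - t / norm (y - x)) *\<^sub>R x + (t / norm (y - x)) *\<^sub>R y"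
    by (simp add: algebra_simps)
  then show ?thesis
    using assms convex_domain by (simp add: convexD_alt)
qed

section \<open>Derivatives along segments and uniqueness of the gradient\<close>

lemma has_derivative_line:
  fixes f :: "real ^ 'n \<Rightarrow> real"
  assumes "x \<in> P" "y \<in> P" "x \<noteq> y" and t: "t \<in> {0..norm (y - x)}"
    and f: "(f has_derivative (\<bullet>) g) (at (x + (t / norm (y - x)) *\<^sub>R (y - x)) within P)"
  shows "((\<lambda>t. f (x + (t / norm (y - x)) *\<^sub>R (y - x))) has_real_derivative
    (g \<bullet> (y - x)) / norm (y - x)) (at t within {0..norm (y - x)})"
proof -
  let ?r = "norm (y - x)" and ?l = "\<lambda>t. x + (t / norm (y - x)) *\<^sub>R (y - x)"
  have "?l s \<in> P" if "s \<in> {0..?r}" for s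
    using segment_in_domain assms(1-3) that by blast
  then have "(f has_derivative (\<bullet>) g) (at (?l t) within ?l ` {0..?r})"
    by (intro has_derivative_subset[OF f]) auto
  moreover have "(?l has_derivative (\<lambda>h. (h / ?r) *\<^sub>R (y - x))) (at t within {0..?r})"
    using assms(3) by (auto intro!: derivative_eq_intros)
  ultimately have "((\<lambda>t. f (?l t)) has_derivative (\<lambda>h. g \<bullet> ((h / ?r) *\<^sub>R (y - x)))) (at t within {0..?r})"
    by (rule has_derivative_in_compose[rotated])
  moreover have "(\<lambda>h. g \<bullet> ((h / ?r) *\<^sub>R (y - x))) = (*) ((g \<bullet> (y - x)) / ?r)"
    by (simp add: fun_eq_iff)
  ultimately show ?thesis
    by (simp add: has_field_derivative_def)
qed

text \<open>The definition of \<open>W2_interval\<close> only asserts that some derivative exists;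
  this identifies its value at the start of a segment, even when \<open>x\<close> is a boundary
  point of \<open>P\<close>.\<close>

lemma line_derivative_unique:
  fixes f :: "real ^ 'n \<Rightarrow> real"
  assumes "x \<in> P" "y \<in> P" "x \<noteq> y"
    and f: "(f has_derivative (\<bullet>) g) (at x within P)"
    and D: "((\<lambda>t. f (x + (t / norm (y - x)) *\<^sub>R (y - x))) has_real_derivative D)
      (at 0 within {0..norm (y - x)})"
  shows "D * norm (y - x) = g \<bullet> (y - x)"
proof -
  have "((\<lambda>t. f (x + (t / norm (y - x)) *\<^sub>R (y - x))) has_real_derivative
      (g \<bullet> (y - x)) / norm (y - x)) (at 0 within {0..norm (y - x)})"
    using assms by (intro has_derivative_line) auto
  with D have "D = (g \<bullet> (y - x)) / norm (y - x)"
    using \<open>x \<noteq> y\<close> unfolding has_real_derivative_iff_has_vector_derivative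
    by (intro vector_derivative_unique_within_closed_interval[of 0 "norm (y - x)" 0]) auto
  then show ?thesis
    using \<open>x \<noteq> y\<close> by simp
qed

text \<open>Even at a boundary point the segments to all vertices stay in \<open>P\<close>. Two
  gradients thus agree in the directions \<open>v i - x\<close>, so \<open>normal_eq_0\<close>
  applies to their difference.\<close>

lemma grad_unique:
  fixes f :: "real ^ 'n \<Rightarrow> real"
  assumes "x \<in> P" "(f has_derivative (\<bullet>) g) (at x within P)"
    "(f has_derivative (\<bullet>) h) (at x within P)"
  shows "g = h"
proof -
  have "g \<bullet> (v i - x) = h \<bullet> (v i - x)" for i
  proof (cases "v i = x")
    case False
    then have "x \<noteq> v i" by blast
    have "((\<lambda>t. f (x + (t / norm (v i - x)) *\<^sub>R (v i - x))) has_real_derivative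
        (h \<bullet> (v i - x)) / norm (v i - x)) (at 0 within {0..norm (v i - x)})"
      using assms(3) by (intro has_derivative_line assms(1) vertex_in_domain \<open>x \<noteq> v i\<close>) simp_all
    from line_derivative_unique[OF assms(1) vertex_in_domain \<open>x \<noteq> v i\<close> assms(2) this]
    show ?thesis
      using \<open>x \<noteq> v i\<close> by simp
  qed simp
  then have "(g - h) \<bullet> v i = (g - h) \<bullet> x" for i
    by (simp add: inner_diff algebra_simps)
  then show ?thesis
    using normal_eq_0[of "g - h"] by auto
qed

lemma grad_eq:
  assumes "x \<in> P" "(f has_derivative (\<bullet>) g) (at x within P)"
  shows "grad P f x = g"
  unfolding grad_def using assms grad_unique by (intro the_equality) auto

lemma has_derivative_grad:
  fixes f :: "real ^ 'n \<Rightarrow> real"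
  assumes "x \<in> P" "f differentiable (at x within P)"
  shows "(f has_derivative (\<bullet>) (grad P f x)) (at x within P)"
proof -
  obtain L where L: "(f has_derivative L) (at x within P)"
    using assms by (auto simp: differentiable_def)
  \<comment> \<open>Riesz representation: the adjoint of a linear functional, evaluated at 1, is its
    representing vector.\<close>
  then have "L = (\<bullet>) (adjoint L 1)"
    using adjoint_works[OF has_derivative_linear[OF L], of _ 1]
    by (simp add: fun_eq_iff inner_commute)
  with L have "(f has_derivative (\<bullet>) (adjoint L 1)) (at x within P)"
    by simp
  with grad_eq[OF assms(1) this] show ?thesis by simp
qed

section \<open>Taylor estimate in the class and a criterion for membership\<close>

lemma W2_class_taylor:
  assumes f: "f \<in> W2_class P" and "x \<in> P" "y \<in> P"
  shows "\<bar>f y - f x - grad P f x \<bullet> (y - x)\<bar> \<le> (norm (y - x))\<^sup>2 / 2"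
proof (cases "x = y")
  case False
  let ?g = "\<lambda>t. f (x + (t / norm (y - x)) *\<^sub>R (y - x))"
  have "?g \<in> W2_interval 0 (norm (y - x))"
    using f False assms(2,3) by (auto simp: W2_class_def)
  then obtain g' where
    der: "\<And>t. t \<in> {0..norm (y - x)} \<Longrightarrow> (?g has_real_derivative g' t) (at t within {0..norm (y - x)})"
    and lip: "\<And>s t. s \<in> {0..norm (y - x)} \<Longrightarrow> t \<in> {0..norm (y - x)} \<Longrightarrow> \<bar>g' s - g' t\<bar> \<le> \<bar>s - t\<bar>"
    unfolding W2_interval_def by blast
  have "\<bar>?g (norm (y - x)) - ?g 0 - g' 0 * norm (y - x)\<bar> \<le> (norm (y - x))\<^sup>2 / 2"
  proof (rule taylor_bound_Lipschitz_derivative[OF norm_ge_zero der])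
    show "\<bar>g' t - g' 0\<bar> \<le> t" if "t \<in> {0..norm (y - x)}" for t
      using lip[OF that, of 0] that by simp
  qed
  moreover have "(f has_derivative (\<bullet>) (grad P f x)) (at x within P)"
    using f assms(2)
    by (intro has_derivative_grad) (auto simp: W2_class_def C1_space_def differentiable_on_def)
  then have "g' 0 * norm (y - x) = grad P f x \<bullet> (y - x)"
    using False assms(2,3) der[of 0] by (intro line_derivative_unique) auto
  ultimately show ?thesis
    using False by simp
qed simp

lemma continuous_on_W2_class: "f \<in> W2_class P \<Longrightarrow> continuous_on P f"
  by (auto simp: W2_class_def C1_space_def intro: differentiable_imp_continuous_on)

lemma W2_classI:
  fixes f :: "real ^ 'n \<Rightarrow> real"
  assumes der: "\<And>x. x \<in> P \<Longrightarrow> (f has_derivative (\<bullet>) (g x)) (at x within P)"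
    and lip: "\<And>x y. x \<in> P \<Longrightarrow> y \<in> P \<Longrightarrow> norm (g x - g y) \<le> norm (x - y)"
  shows "f \<in> W2_class P"
  unfolding W2_class_def C1_space_def mem_Collect_eq
proof (intro conjI ballI impI)
  show "f differentiable_on P"
    using der by (auto simp: differentiable_on_def differentiable_def)
  have "1-lipschitz_on P g"
    using lip by (auto intro!: lipschitz_onI simp: dist_norm)
  then have "continuous_on P g"
    by (rule lipschitz_on_continuous_on)
  then show "continuous_on P (grad P f)"
    using grad_eq[OF _ der] by (simp cong: continuous_on_cong)
next
  fix x y assume xy: "x \<in> P" "y \<in> P" "x \<noteq> y"
  let ?r = "norm (y - x)" and ?l = "\<lambda>t. x + (t / norm (y - x)) *\<^sub>R (y - x)"
  \<comment> \<open>The line has unit speed, so this is the directional derivative; Cauchy-Schwarz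
    passes the Lipschitz bound of \<open>g\<close> on to it.\<close>
  let ?g' = "\<lambda>t. (g (?l t) \<bullet> (y - x)) / ?r"
  have l: "?l s \<in> P" if "s \<in> {0..?r}" for s
    using segment_in_domain xy that by blast
  show "(\<lambda>t. f (?l t)) \<in> W2_interval 0 ?r"
    unfolding W2_interval_def mem_Collect_eq
  proof (intro exI[of _ ?g'] conjI ballI)
    show "((\<lambda>t. f (?l t)) has_real_derivative ?g' t) (at t within {0..?r})" if "t \<in> {0..?r}" for t
      using that xy by (intro has_derivative_line der l)
    fix s t assume st: "s \<in> {0..?r}" "t \<in> {0..?r}"
    have "\<bar>?g' s - ?g' t\<bar> = \<bar>(g (?l s) - g (?l t)) \<bullet> (y - x)\<bar> / ?r"
      by (simp add: inner_diff_left diff_divide_distrib[symmetric])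
    also have "\<dots> \<le> norm (g (?l s) - g (?l t))"
      using xy(3) by (simp add: divide_le_eq Cauchy_Schwarz_ineq2)
    also have "\<dots> \<le> norm (?l s - ?l t)"
      using l st by (intro lip)
    also have "?l s - ?l t = ((s - t) / ?r) *\<^sub>R (y - x)"
      by (simp add: diff_divide_distrib scaleR_diff_left)
    also have "norm \<dots> = \<bar>s - t\<bar>"
      using xy(3) by simp
    finally show "\<bar>?g' s - ?g' t\<bar> \<le> \<bar>s - t\<bar>" .
  qed
qed

lemma err_fun_in_W2_class: "err_fun v \<in> W2_class P"
  by (rule W2_classI[OF err_fun_has_derivative norm_err_grad_diff_le])

lemma minus_err_fun_has_derivative:
  "((\<lambda>w. - err_fun v w) has_derivative (\<bullet>) (- err_grad w)) (at w within X)"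
  using has_derivative_minus[OF err_fun_has_derivative[of w X]] by (simp add: inner_minus_left[abs_def])

lemma minus_err_fun_in_W2_class: "(\<lambda>w. - err_fun v w) \<in> W2_class P"
proof (rule W2_classI[OF minus_err_fun_has_derivative])
  show "norm (- err_grad x - - err_grad y) \<le> norm (x - y)" for x y
    using norm_err_grad_diff_le[of x y] by (simp add: norm_minus_commute)
qed

lemma info_err_fun: "info v P (err_fun v) = 0" "info v P (\<lambda>w. - err_fun v w) = 0"
proof -
  have "grad P (err_fun v) (v i) = 0" "grad P (\<lambda>w. - err_fun v w) (v i) = 0" for i
    by (simp_all add: grad_eq[OF vertex_in_domain err_fun_has_derivative]
        grad_eq[OF vertex_in_domain minus_err_fun_has_derivative] err_grad_vertex)
  then show "info v P (err_fun v) = 0" "info v P (\<lambda>w. - err_fun v w) = 0"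
    by (simp_all add: info_def err_fun_vertex prod_eq_iff vec_eq_iff)
qed

section \<open>Optimality\<close>

lemma recovery_error_le:
  assumes f: "f \<in> W2_class P" and w: "w \<in> P"
  shows "\<bar>f w - recovery v (info v P f) w\<bar> \<le> err_fun v w"
proof -
  let ?p = "proj v w" and ?c = "circumcenter v" and ?u = "half_vertex v"
  define b where "b = bary v ?p"
  \<comment> \<open>These are the points \<open>w_i\<close> of the overview.\<close>
  define z where "z i = w - ?p + ?u i" for i
  have b: "?p = (\<Sum>i\<in>UNIV. b i *\<^sub>R ?u i)" "(\<Sum>i\<in>UNIV. b i) = 1" "0 \<le> b i" for i
    unfolding b_def using bary[OF proj_in_half_simplex] by auto
  have zP: "z i \<in> P" if "b i \<noteq> 0" for i
  proof -
    \<comment> \<open>The support of the weights is the index set of the open face containing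
      \<open>?p\<close>, so admissibility places \<open>z i\<close> in \<open>P\<close> exactly for
      the indices needed.\<close>
    let ?I = "{i. 0 < b i}"
    have "?p \<in> open_face v ?I"
      using b(3) proj_in_half_simplex[of w]
      by (auto simp: open_face_def b_def[symmetric] order.order_iff_strict)
    moreover have "i \<in> ?I"
      using that b(3)[of i] by simp
    ultimately show ?thesis
      unfolding z_def by (rule shift_in_domain[OF w])
  qed
  \<comment> \<open>Taylor remainders at \<open>z i\<close> from the vertex and from
    \<open>w\<close>: the unknown values \<open>f (z i)\<close> cancel in
    \<open>?A i - ?B i\<close>, and the gradient at \<open>w\<close> disappears by averaging because
    \<open>w\<close> is the mean of the \<open>z i\<close>.\<close>
  let ?A = "\<lambda>i. f (z i) - f (v i) - grad P f (v i) \<bullet> (z i - v i)"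
    and ?B = "\<lambda>i. f (z i) - f w - grad P f w \<bullet> (z i - w)"
  have z_mean: "(\<Sum>i\<in>UNIV. b i *\<^sub>R (z i - w)) = 0"
    using b(1,2) unfolding z_def
    by (simp add: scaleR_add_right scaleR_diff_right sum.distrib sum_subtractf scaleR_sum_left[symmetric])
  have "f w - recovery v (info v P f) w = (\<Sum>i\<in>UNIV. b i * (?A i - ?B i))"
  proof -
    have "w - ?p + (1/2) *\<^sub>R (?c - v i) = z i - v i" for i
      by (simp add: z_def half_vertex_def vec_eq_iff field_simps)
    then have "(\<Sum>i\<in>UNIV. b i * (?A i - ?B i))
      = (\<Sum>i\<in>UNIV. b i) * f w - recovery v (info v P f) w
        + grad P f w \<bullet> (\<Sum>i\<in>UNIV. b i *\<^sub>R (z i - w))"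
      unfolding recovery_def info_def b_def[symmetric] sum_distrib_right inner_sum_right
        sum_subtractf[symmetric] sum.distrib[symmetric]
      by (intro sum.cong refl) (simp add: right_diff_distrib distrib_left)
    then show ?thesis
      using z_mean b(2) by simp
  qed
  also have "\<bar>\<dots>\<bar> \<le> (\<Sum>i\<in>UNIV. b i * ((norm (z i - v i))\<^sup>2 / 2 + (norm (z i - w))\<^sup>2 / 2))"
  proof (rule order_trans[OF sum_abs], rule sum_mono)
    fix i
    show "\<bar>b i * (?A i - ?B i)\<bar> \<le> b i * ((norm (z i - v i))\<^sup>2 / 2 + (norm (z i - w))\<^sup>2 / 2)"
    \<comment> \<open>With zero weight \<open>z i\<close> need not lie in \<open>P\<close> and no
      Taylor bound is available, but the term vanishes.\<close>
    proof (cases "b i = 0")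
      case False
      then have "\<bar>?A i\<bar> \<le> (norm (z i - v i))\<^sup>2 / 2" "\<bar>?B i\<bar> \<le> (norm (z i - w))\<^sup>2 / 2"
        by (intro W2_class_taylor f zP vertex_in_domain w; simp)+
      then have "\<bar>?A i - ?B i\<bar> \<le> (norm (z i - v i))\<^sup>2 / 2 + (norm (z i - w))\<^sup>2 / 2"
        by linarith
      then show ?thesis
        using b(3)[of i] by (simp add: abs_mult mult_left_mono)
    qed simp
  qed
  also have "\<dots> = err_fun v w"
  proof -
    \<comment> \<open>Coordinates centered at the circumcenter: all \<open>q i\<close> have length
      R/2, and their weighted mean is \<open>m\<close>.\<close>
    define q where "q i = ?u i - ?c" for i
    define a m where "a = w - ?p" and "m = ?p - ?c"
    have q: "(\<Sum>i\<in>UNIV. b i *\<^sub>R q i) = m"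
      using b(1,2) by (simp add: q_def m_def scaleR_diff_right sum_subtractf scaleR_sum_left[symmetric])
    have v: "v i = ?c + 2 *\<^sub>R q i" for i
      by (simp add: q_def half_vertex_def vec_eq_iff field_simps)
    have radius: "circumradius v = 2 * norm (q i)" for i
      using dist_circumcenter[of i] by (simp add: v dist_norm)
    have nq: "q i \<bullet> q i = (circumradius v)\<^sup>2 / 4" for i
      by (simp add: radius[of i] power2_norm_eq_inner[symmetric] power_mult_distrib)
    \<comment> \<open>As \<open>q i \<bullet> q i\<close> is the same for all \<open>i\<close>, the
      expression is affine in \<open>q i\<close>, and averaging just replaces \<open>q i\<close> by
      \<open>m\<close>.\<close>
    have eq: "(norm (z i - v i))\<^sup>2 / 2 + (norm (z i - w))\<^sup>2 / 2
      = (a \<bullet> a + m \<bullet> m) / 2 + (circumradius v)\<^sup>2 / 4 - (a + m) \<bullet> q i" for i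
    proof -
      have "z i - v i = a - q i" "z i - w = q i - m"
        by (simp_all add: v[of i] z_def a_def m_def q_def algebra_simps scaleR_2)
      then have "(norm (z i - v i))\<^sup>2 / 2 + (norm (z i - w))\<^sup>2 / 2
        = ((a - q i) \<bullet> (a - q i) + (q i - m) \<bullet> (q i - m)) / 2"
        by (simp only: power2_norm_eq_inner add_divide_distrib)
      also have "\<dots> = (a \<bullet> a + m \<bullet> m) / 2 + q i \<bullet> q i - (a + m) \<bullet> q i"
        by (simp add: inner_diff inner_add inner_commute add_divide_distrib diff_divide_distrib)
      finally show ?thesis by (simp only: nq)
    qed
    have "(\<Sum>i\<in>UNIV. b i * ((norm (z i - v i))\<^sup>2 / 2 + (norm (z i - w))\<^sup>2 / 2))
      = (\<Sum>i\<in>UNIV. b i) * ((a \<bullet> a + m \<bullet> m) / 2 + (circumradius v)\<^sup>2 / 4)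
        - (a + m) \<bullet> (\<Sum>i\<in>UNIV. b i *\<^sub>R q i)"
      unfolding eq sum_distrib_right inner_sum_right sum_subtractf[symmetric]
      by (simp only: right_diff_distrib inner_scaleR_right)
    also have "\<dots> = (a \<bullet> a + m \<bullet> m) / 2 + (circumradius v)\<^sup>2 / 4 - (a + m) \<bullet> m"
      by (simp only: b(2) q mult_1)
    also have "\<dots> = (circumradius v)\<^sup>2 / 4 + a \<bullet> a - ((a + m) \<bullet> (a + m)) / 2"
      by (simp add: inner_add_left inner_add_right inner_commute add_divide_distrib)
    also have "\<dots> = err_fun v w"
    proof -
      have "a + m = w - ?c" by (simp add: a_def m_def)
      then show ?thesis
        by (simp only: err_fun_def power2_norm_eq_inner a_def)
    qed
    finally show ?thesis .
  qed
  finally show ?thesis .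
qed

text \<open>The error function bounds an absolute error, here for the class member
  \<open>err_fun v\<close> itself. Monotonicity of the seminorm later needs this sign.\<close>

lemma err_fun_nonneg: "w \<in> P \<Longrightarrow> 0 \<le> err_fun v w"
  by (rule order_trans[OF abs_ge_zero recovery_error_le[OF err_fun_in_W2_class]])

lemma point_error_lower: "ereal (err_fun v w) \<le> point_error_of v P w (W2_class P) \<Psi>"
proof -
  have "ereal (err_fun v w) \<le> max (ereal \<bar>err_fun v w - \<Psi> 0\<bar>) (ereal \<bar>- err_fun v w - \<Psi> 0\<bar>)"
    by (auto simp: max_def)
  also have "\<dots> \<le> point_error_of v P w (W2_class P) \<Psi>"
    unfolding point_error_of_def
    using SUP_upper[OF err_fun_in_W2_class, of "\<lambda>f. ereal \<bar>f w - \<Psi> (info v P f)\<bar>"]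
      SUP_upper[OF minus_err_fun_in_W2_class, of "\<lambda>f. ereal \<bar>f w - \<Psi> (info v P f)\<bar>"]
    by (simp add: info_err_fun)
  finally show ?thesis .
qed

lemma point_error_upper:
  assumes "w \<in> P"
  shows "point_error_of v P w (W2_class P) (\<lambda>Y. recovery v Y w) \<le> ereal (err_fun v w)"
  unfolding point_error_of_def using recovery_error_le[OF _ assms] by (intro SUP_least) simp

lemma point_error_eq:
  assumes "w \<in> P"
  shows "point_error_of v P w (W2_class P) (\<lambda>Y. recovery v Y w) = ereal (err_fun v w)"
    and "point_error v P w (W2_class P) = ereal (err_fun v w)"
proof -
  show "point_error_of v P w (W2_class P) (\<lambda>Y. recovery v Y w) = ereal (err_fun v w)"
    using point_error_upper[OF assms] point_error_lower by (rule antisym)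
  show "point_error v P w (W2_class P) = ereal (err_fun v w)"
  proof (rule antisym)
    show "point_error v P w (W2_class P) \<le> ereal (err_fun v w)"
      unfolding point_error_def
      by (rule INF_lower2[OF UNIV_I], rule point_error_upper[OF assms])
    show "ereal (err_fun v w) \<le> point_error v P w (W2_class P)"
      unfolding point_error_def by (intro INF_greatest point_error_lower)
  qed
qed

context
  fixes N
  assumes N: "monotone_seminorm P N"
begin

lemma seminorm_minus:
  assumes "f \<in> C_space P"
  shows "N (\<lambda>x. - f x) = N f"
proof -
  have "\<forall>f\<in>C_space P. \<forall>a. N (\<lambda>x. a * f x) = \<bar>a\<bar> * N f"
    using N unfolding monotone_seminorm_def by (elim conjE)
  from spec[OF bspec[OF this assms], of "-1"] show ?thesis by simp
qed

lemma global_error_lower: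
  assumes "\<Phi> 0 \<in> C_space P"
  shows "ereal (N (err_fun v)) \<le> global_error_of v P N (W2_class P) \<Phi>"
proof -
  let ?E = "err_fun v"
  have C: "?E \<in> C_space P" "(\<lambda>x. ?E x - \<Phi> 0 x) \<in> C_space P"
      "(\<lambda>x. ?E x + \<Phi> 0 x) \<in> C_space P"
    using assms continuous_on_err_fun[of P]
    by (simp_all add: C_space_def continuous_on_diff continuous_on_add)
  have triangle: "\<forall>f\<in>C_space P. \<forall>g\<in>C_space P. N (\<lambda>x. f x + g x) \<le> N f + N g"
    using N unfolding monotone_seminorm_def by (elim conjE)
  have "2 * N ?E = N (\<lambda>x. 2 * ?E x)"
    using N C(1) by (simp add: monotone_seminorm_def)
  also have "\<dots> = N (\<lambda>x. (?E x - \<Phi> 0 x) + (?E x + \<Phi> 0 x))"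
    by simp
  also have "\<dots> \<le> N (\<lambda>x. ?E x - \<Phi> 0 x) + N (\<lambda>x. ?E x + \<Phi> 0 x)"
    by (rule bspec[OF bspec[OF triangle C(2)] C(3)])
  also have "N (\<lambda>x. ?E x + \<Phi> 0 x) = N (\<lambda>x. - ?E x - \<Phi> 0 x)"
    using seminorm_minus[OF C(3)] by simp
  finally have "ereal (N ?E) \<le> max (ereal (N (\<lambda>x. ?E x - \<Phi> 0 x))) (ereal (N (\<lambda>x. - ?E x - \<Phi> 0 x)))"
    by (auto simp: max_def)
  also have "\<dots> \<le> global_error_of v P N (W2_class P) \<Phi>"
    unfolding global_error_of_def
    using SUP_upper[OF err_fun_in_W2_class, of "\<lambda>f. ereal (N (\<lambda>x. f x - \<Phi> (info v P f) x))"]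
      SUP_upper[OF minus_err_fun_in_W2_class, of "\<lambda>f. ereal (N (\<lambda>x. f x - \<Phi> (info v P f) x))"]
    by (simp add: info_err_fun)
  finally show ?thesis .
qed

lemma global_error_upper: "global_error_of v P N (W2_class P) (recovery v) \<le> ereal (N (err_fun v))"
  unfolding global_error_of_def
proof (rule SUP_least)
  fix f assume f: "f \<in> W2_class P"
  have "(\<lambda>x. f x - recovery v (info v P f) x) \<in> C_space P" "err_fun v \<in> C_space P"
    using continuous_on_W2_class[OF f] continuous_on_recovery[of P "info v P f"] continuous_on_err_fun[of P]
    by (simp_all add: C_space_def continuous_on_diff)
  then have "N (\<lambda>x. f x - recovery v (info v P f) x) \<le> N (err_fun v)"
    using N recovery_error_le[OF f] err_fun_nonneg by (simp add: monotone_seminorm_def)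
  then show "ereal (N (\<lambda>x. f x - recovery v (info v P f) x)) \<le> ereal (N (err_fun v))"
    by simp
qed

lemma global_error_eq:
  "global_error_of v P N (W2_class P) (recovery v) = ereal (N (err_fun v))"
  "global_error v P N (W2_class P) = ereal (N (err_fun v))"
proof -
  have C: "recovery v \<in> UNIV \<rightarrow> C_space P"
    by (simp add: C_space_def continuous_on_recovery)
  then show "global_error_of v P N (W2_class P) (recovery v) = ereal (N (err_fun v))"
    by (intro antisym global_error_upper global_error_lower) auto
  show "global_error v P N (W2_class P) = ereal (N (err_fun v))"
    unfolding global_error_def
  proof (rule antisym)
    show "(INF \<Phi>\<in>UNIV \<rightarrow> C_space P. global_error_of v P N (W2_class P) \<Phi>) \<le> ereal (N (err_fun v))"
      by (rule INF_lower2[OF C], rule global_error_upper)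
    show "ereal (N (err_fun v)) \<le> (INF \<Phi>\<in>UNIV \<rightarrow> C_space P. global_error_of v P N (W2_class P) \<Phi>)"
      by (intro INF_greatest global_error_lower) auto
  qed
qed

end

end

end

theorem theorem4p1:
  fixes v :: "'i::finite \<Rightarrow> real ^ 'n" and P :: "(real ^ 'n) set"
  assumes "nondegenerate_simplex v"
    and "admissible_domain v P"
  shows "(\<forall>w\<in>P.
           (\<forall>f\<in>W2_class P. p_method v P f w = recovery v (info v P f) w) \<and>
           point_error_of v P w (W2_class P) (\<lambda>Y. recovery v Y w) = point_error v P w (W2_class P) \<and>
           point_error v P w (W2_class P) = ereal (err_fun v w))
       \<and> (\<forall>Y. recovery v Y \<in> C_space P) \<and> err_fun v \<in> C_space P
       \<and> (\<forall>N. monotone_seminorm P N \<longrightarrow>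
           global_error_of v P N (W2_class P) (recovery v) = global_error v P N (W2_class P) \<and>
           global_error v P N (W2_class P) = ereal (N (err_fun v)))"
  using point_error_eq[OF assms] global_error_eq[OF assms] continuous_on_recovery[OF assms(1)]
    continuous_on_err_fun[OF assms(1)]
  by (simp add: p_method_def recovery_def info_def C_space_def)

end
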